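(* Let $m\in\{3,4,6\}$ (i.e. $m$ is a positive integer with $\varphi(m)=2$) and let $p$ be a prime greater than $3$. Then for any $t\in D_p$ the following congruences hold modulo $p$: \begin{align*} \sum_{k=0}^{\lfloor p/m\rfloor}\frac{\left(\frac{1}{m}\right)_k\left(\frac{m-1}{m}\right)_k}{(2k+1)!}\,t^k&\equiv \frac{1}{1+2\lfloor p/m\rfloor}\,w_{\lfloor p/m\rfloor}(1-t/2),\\ \sum_{k=0}^{\lfloor p/m\rfloor}\frac{\left(\frac{1}{m}\right)_k\left(\frac{m-1}{m}\right)_k}{(2k)!}\, t^k&\equiv (-1)^{\lfloor p/m\rfloor}\, w_{\lfloor p/m\rfloor}(t/2-1),\\ \sum_{k=(p-1)/2}^{\lfloor(m-1)p/m\rfloor}\frac{\left(\frac{1}{m}\right)_k\left(\frac{m-1}{m}\right)_k}{(2k+1)!}\,t^k&\equiv \frac{-1}{m(1+2\lfloor p/m\rfloor)}\Bigl(w_{\lfloor (m-1)p/m\rfloor}(1-t/2)+w_{\lfloor p/m\rfloor}(1-t/2)\Bigr),\\ \sum_{k=(p+1)/2}^{\lfloor(m-1)p/m\rfloor}\frac{\left(\frac{1}{m}\right)_k\left(\frac{m-1}{m}\right)_k}{(2k)!}\, t^k&\equiv \frac{(-1)^{\lfloor p/m\rfloor}}{m}\Bigl(w_{\lfloor (m-1)p/m\rfloor}(t/2-1)-w_{\lfloor p/m\rfloor}(t/2-1)\Bigr). \end{align*}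
   Context: $(a)_0=1$, $(a)_k=a(a+1)\cdots(a+k-1)$ is the Pochhammer symbol. The polynomials $w_n(x)$ are defined by $w_0(x)=1$, $w_1(x)=1+2x$, $w_{n+1}(x)=2xw_n(x)-w_{n-1}(x)$; equivalently $w_n(x)=(2n+1)\,{}_2F_1(-n,n+1;3/2;(1-x)/2)$. For a prime $p$, $D_p$ denotes the set of rational numbers whose denominator is not divisible by $p$, and for $a,b\in D_p$, $a\equiv b \pmod p$ means that $a-b$ has numerator divisible by $p$. *)

theory Defs
  imports Complex_Main "HOL-Computational_Algebra.Computational_Algebra"
begin

fun w :: "nat \<Rightarrow> 'a::comm_ring_1 poly" where
  "w 0 = 1"
| "w (Suc 0) = [:1, 2:]"
| "w (Suc (Suc n)) = [:0, 2:] * w (Suc n) - w n"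

text \<open>\<^const>\<open>quotient_of\<close> returns numerator and denominator in lowest terms, with positive
  denominator.\<close>

definition D :: "nat \<Rightarrow> rat set" where
  "D p = {r. \<not> int p dvd snd (quotient_of r)}"

text \<open>The congruence is a relation on \<^term>\<open>D p\<close>: it holds only between \<open>p\<close>-integral
  rationals, so a congruence between two expressions includes their \<open>p\<close>-integrality.\<close>

definition rat_cong :: "rat \<Rightarrow> rat \<Rightarrow> nat \<Rightarrow> bool" where
  "rat_cong a b p \<longleftrightarrow> a \<in> D p \<and> b \<in> D p \<and> int p dvd fst (quotient_of (a - b))"

end

theory Submission
  imports Defs
begin

text \<open>Write \<open>(a)\<^sub>k (1 - a)\<^sub>k\<close> as the product of \<open>(j + a) (j + 1 - a)\<close> over \<open>j < k\<close>. The recurrence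
  for \<open>w\<close> is the second difference of binomial coefficients, so \<open>w\<^sub>n (1 - t / 2) / (2 n + 1)\<close> and
  \<open>(- 1)\<^sup>n w\<^sub>n (t / 2 - 1)\<close> are the sums in question with \<open>a = - n\<close>. Put \<open>n = \<lfloor>p / m\<rfloor>\<close>,
  \<open>N = p - 1 - n = \<lfloor>(m - 1) p / m\<rfloor>\<close> and \<open>a = (p mod m) / m = p / m - n\<close>; since \<open>p\<close> is \<open>1\<close> or
  \<open>- 1\<close> modulo \<open>m\<close>, \<open>a\<close> is \<open>1 / m\<close> or \<open>1 - 1 / m\<close>. As \<open>a \<equiv> - n \<equiv> N + 1\<close> modulo \<open>p\<close>, the
  low terms agree termwise. In the high terms both the factorial and the product (through \<open>j = n\<close>)
  contain a factor \<open>p\<close>, and cancelling it turns the sum for \<open>a\<close> into \<open>1 / m\<close> times the sum for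
  \<open>- N\<close>, that is, into \<open>w\<^sub>N\<close> minus its low terms, which amount to \<open>w\<^sub>n\<close>.\<close>

section \<open>Congruences between \<open>p\<close>-integral rationals\<close>

text \<open>The reduced denominator divides the denominator of any other representation, so
  \<open>p\<close>-integrality can be checked without lowest terms.\<close>

lemma D_iff: "r \<in> D p \<longleftrightarrow> (\<exists>a b. r = of_int a / of_int b \<and> \<not> int p dvd b)"
proof
  assume "r \<in> D p"
  then show "\<exists>a b. r = of_int a / of_int b \<and> \<not> int p dvd b"
    unfolding D_def by (metis mem_Collect_eq quotient_of_div prod.collapse)
next
  assume "\<exists>a b. r = of_int a / of_int b \<and> \<not> int p dvd b"
  then obtain a b where r: "r = of_int a / of_int b" and b: "\<not> int p dvd b" by blast
  obtain n d where q: "quotient_of r = (n, d)" by fastforce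
  have rd: "r = of_int n / of_int d" using q by (rule quotient_of_div)
  have d: "d > 0" using q by (rule quotient_of_denom_pos)
  have cop: "coprime n d" using q by (rule quotient_of_coprime)
  have "b \<noteq> 0" using b by auto
  have "(of_int (n * b) :: rat) = of_int (a * d)"
    using r rd d \<open>b \<noteq> 0\<close> by (simp add: field_simps)
  then have "n * b = a * d" by (simp only: of_int_eq_iff)
  then have "d dvd b" using cop
    by (metis coprime_commute coprime_dvd_mult_right_iff dvd_triv_right)
  then show "r \<in> D p" using b q unfolding D_def by (auto dest: dvd_trans)
qed

lemma D_of_int [simp]: "prime p \<Longrightarrow> of_int a \<in> D p"
  unfolding D_iff by (rule exI[of _ a], rule exI[of _ 1]) (auto dest: not_prime_unit)

lemma D_of_nat [simp]: "prime p \<Longrightarrow> of_nat a \<in> D p"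
  using D_of_int[of p "int a"] by simp

lemma D_numeral [simp]: "prime p \<Longrightarrow> numeral a \<in> D p"
  using D_of_nat[of p "numeral a"] by simp

lemma D_0_1 [simp]: "prime p \<Longrightarrow> 0 \<in> D p" "prime p \<Longrightarrow> 1 \<in> D p"
  using D_of_nat[of p 0] D_of_nat[of p 1] by simp_all

lemma D_add [intro]:
  assumes "prime p" "x \<in> D p" "y \<in> D p" shows "x + y \<in> D p"
proof -
  obtain a b c d where *: "x = of_int a / of_int b" "\<not> int p dvd b"
    "y = of_int c / of_int d" "\<not> int p dvd d" using assms D_iff by metis
  moreover have "b \<noteq> 0" "d \<noteq> 0" using * by auto
  ultimately have "x + y = of_int (a * d + c * b) / of_int (b * d)"
    by (simp add: field_simps)
  moreover have "\<not> int p dvd b * d"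
    using * assms(1) by (simp add: prime_dvd_mult_iff)
  ultimately show ?thesis unfolding D_iff by blast
qed

lemma D_mult [intro]:
  assumes "prime p" "x \<in> D p" "y \<in> D p" shows "x * y \<in> D p"
proof -
  obtain a b c d where *: "x = of_int a / of_int b" "\<not> int p dvd b"
    "y = of_int c / of_int d" "\<not> int p dvd d" using assms D_iff by metis
  then have "x * y = of_int (a * c) / of_int (b * d)"
    by (auto simp: field_simps)
  moreover have "\<not> int p dvd b * d"
    using * assms(1) by (simp add: prime_dvd_mult_iff)
  ultimately show ?thesis unfolding D_iff by blast
qed

lemma D_uminus [intro]: "prime p \<Longrightarrow> x \<in> D p \<Longrightarrow> - x \<in> D p"
  using D_mult[of p "of_int (-1)" x] D_of_int[of p "-1"] by simp

lemma D_diff [intro]: "prime p \<Longrightarrow> x \<in> D p \<Longrightarrow> y \<in> D p \<Longrightarrow> x - y \<in> D p"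
  using D_add[of p x "- y"] D_uminus by simp

lemma D_power [intro]: "prime p \<Longrightarrow> x \<in> D p \<Longrightarrow> x ^ k \<in> D p"
  by (induction k) auto

lemma D_divide_of_nat:
  assumes "prime p" "x \<in> D p" "\<not> p dvd n" shows "x / of_nat n \<in> D p"
proof -
  have "1 / of_nat n \<in> D p"
    unfolding D_iff using assms by (intro exI[of _ 1] exI[of _ "int n"]) auto
  then show ?thesis using D_mult[OF assms(1,2)] by fastforce
qed

lemma D_poly_w: "prime p \<Longrightarrow> x \<in> D p \<Longrightarrow> poly (w n) x \<in> D p"
proof (induction n rule: w.induct)
  case 2
  then show ?case by (auto simp: mult.commute[of x] intro!: D_add D_mult)
next
  case (3 n)
  then show ?case by (auto intro!: D_diff D_mult)
qed simp

text \<open>Replaces the reduced numerator by membership of the difference in the ideal of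
  \<open>D p\<close> generated by \<open>p\<close>, which makes the congruence rules plain ring
  algebra.\<close>

lemma rat_cong_iff:
  assumes "prime p"
  shows "rat_cong a b p \<longleftrightarrow> a \<in> D p \<and> b \<in> D p \<and> (\<exists>c\<in>D p. a - b = of_nat p * c)"
proof (cases "a \<in> D p \<and> b \<in> D p")
  case True
  obtain n d where q: "quotient_of (a - b) = (n, d)" by fastforce
  have ab: "a - b = of_int n / of_int d" using q by (rule quotient_of_div)
  have d: "d > 0" using q by (rule quotient_of_denom_pos)
  have "a - b \<in> D p" using True assms by blast
  then have pd: "\<not> int p dvd d" using q by (simp add: D_def)
  have "int p dvd n \<longleftrightarrow> (\<exists>c\<in>D p. a - b = of_nat p * c)"
  proof
    assume "int p dvd n"
    then obtain k where "n = int p * k" by blast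
    then have "a - b = of_nat p * (of_int k / of_int d)" using ab by simp
    moreover have "of_int k / of_int d \<in> D p" unfolding D_iff using pd by blast
    ultimately show "\<exists>c\<in>D p. a - b = of_nat p * c" by blast
  next
    assume "\<exists>c\<in>D p. a - b = of_nat p * c"
    then obtain x y where xy: "a - b = of_nat p * (of_int x / of_int y)" "\<not> int p dvd y"
      using D_iff by metis
    have "y \<noteq> 0" using xy by auto
    then have "(of_int (n * y) :: rat) = of_int (int p * x * d)"
      using xy(1) ab d by (simp add: field_simps)
    then have "n * y = int p * (x * d)" by (simp only: of_int_eq_iff mult.assoc)
    then have "int p dvd n * y" by simp
    then show "int p dvd n" using xy(2) assms by (simp add: prime_dvd_mult_iff)
  qed
  then show ?thesis using True q by (simp add: rat_cong_def)
qed (auto simp: rat_cong_def)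

lemma rat_congD: "rat_cong a b p \<Longrightarrow> a \<in> D p" "rat_cong a b p \<Longrightarrow> b \<in> D p"
  by (simp_all add: rat_cong_def)

lemma rat_cong_refl: "prime p \<Longrightarrow> a \<in> D p \<Longrightarrow> rat_cong a a p"
  by (auto simp: rat_cong_iff intro: bexI[of _ 0])

lemma rat_cong_sym:
  assumes "prime p" "rat_cong a b p" shows "rat_cong b a p"
proof -
  obtain c where c: "c \<in> D p" "a - b = of_nat p * c" using assms rat_cong_iff by blast
  have "b - a = of_nat p * (- c)" using c(2) by simp
  then show ?thesis using assms c(1) by (auto simp: rat_cong_iff intro!: bexI[of _ "- c"])
qed

lemma rat_cong_add:
  assumes "prime p" "rat_cong a b p" "rat_cong c d p" shows "rat_cong (a + c) (b + d) p"
proof -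
  obtain x y where x: "x \<in> D p" "a - b = of_nat p * x" and y: "y \<in> D p" "c - d = of_nat p * y"
    using assms rat_cong_iff by metis
  have "a + c - (b + d) = of_nat p * (x + y)" using x(2) y(2) by (simp add: algebra_simps)
  then show ?thesis unfolding rat_cong_iff[OF assms(1)] using assms x(1) y(1) rat_congD by blast
qed

lemma rat_cong_mult:
  assumes "prime p" "rat_cong a b p" "rat_cong c d p" shows "rat_cong (a * c) (b * d) p"
proof -
  obtain x y where x: "x \<in> D p" "a - b = of_nat p * x" and y: "y \<in> D p" "c - d = of_nat p * y"
    using assms rat_cong_iff by metis
  have "a * c - b * d = (a - b) * c + b * (c - d)" by (simp add: algebra_simps)
  also have "\<dots> = of_nat p * (x * c + b * y)" using x(2) y(2) by (simp add: algebra_simps)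
  finally show ?thesis unfolding rat_cong_iff[OF assms(1)] using assms x(1) y(1) rat_congD by blast
qed

text \<open>Primality is the last premise so that \<open>also\<close> can match the two congruences;
  a chain ends by supplying it.\<close>

lemma rat_cong_trans [trans]:
  assumes "rat_cong a b p" "rat_cong b c p" "prime p" shows "rat_cong a c p"
proof -
  \<comment> \<open>The middle term \<open>b\<close> cancels in the difference of the two
    sides.\<close>
  have "rat_cong (a + b) (b + c) p" using assms rat_cong_add by blast
  then show ?thesis using assms by (simp add: rat_cong_def add.commute[of a])
qed

lemma rat_cong_diff:
  assumes "prime p" "rat_cong a b p" "rat_cong c d p" shows "rat_cong (a - c) (b - d) p"
proof -
  have "rat_cong (- 1 * c) (- 1 * d) p"
    using assms rat_cong_mult rat_cong_refl by (metis D_0_1(2) D_uminus)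
  then show ?thesis using rat_cong_add[OF assms(1,2)] by fastforce
qed

lemma rat_cong_sum:
  assumes "prime p" "\<And>i. i \<in> I \<Longrightarrow> rat_cong (f i) (g i) p"
  shows "rat_cong (sum f I) (sum g I) p"
  using assms(2) by (induction I rule: infinite_finite_induct)
    (auto simp: assms(1) rat_cong_refl intro: rat_cong_add)

lemma rat_cong_prod:
  assumes "prime p" "\<And>i. i \<in> I \<Longrightarrow> rat_cong (f i) (g i) p"
  shows "rat_cong (prod f I) (prod g I) p"
  using assms(2) by (induction I rule: infinite_finite_induct)
    (auto simp: assms(1) rat_cong_refl intro: rat_cong_mult)

lemma rat_cong_divide:
  assumes "prime p" "rat_cong a b p" "\<not> p dvd n"
  shows "rat_cong (a / of_nat n) (b / of_nat n) p"
  using rat_cong_mult[OF assms(1,2) rat_cong_refl[of p "1 / of_nat n"]] D_divide_of_nat[of p 1 n] assms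
  by simp

section \<open>Hypergeometric expansion of \<open>w\<close>\<close>

text \<open>Factors of equal index are kept together so that the pair at \<open>j = n\<close>, which
  later carries a factor \<open>p\<close>, can be split off as a whole.\<close>

definition qpoch :: "'a::field_char_0 \<Rightarrow> nat \<Rightarrow> 'a" where
  "qpoch a k = (\<Prod>j<k. (of_nat j + a) * (of_nat j + 1 - a))"

lemma qpoch_eq_pochhammer: "qpoch a k = pochhammer a k * pochhammer (1 - a) k"
  unfolding qpoch_def prod.distrib pochhammer_prod
  by (simp add: atLeast0LessThan algebra_simps)

text \<open>Identifies the parameter \<open>1 / m\<close> with \<open>1 - 1 / m\<close>, and
  \<open>- N\<close> with \<open>1 + N\<close>.\<close>

lemma qpoch_swap: "qpoch (1 - a) k = qpoch a k"
  by (simp add: qpoch_eq_pochhammer mult.commute)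

lemma qpoch_neg_eq_0: "n < k \<Longrightarrow> qpoch (- of_nat n) k = 0"
  unfolding qpoch_def by (rule prod_zero) (auto intro!: bexI[of _ n])

text \<open>Both sides equal \<open>(n + k) * ((n + k - 1) choose (2 * k))\<close>. For
  \<open>k > n\<close> the truncated difference and the binomials are zero.\<close>

lemma times_binomial_odd:
  "(2 * k + 1) * ((n + k) choose (2 * k + 1)) = (n - k) * ((n + k) choose (2 * k))"
  using binomial_absorb_comp[of "n + k" "2 * k"] times_binomial_minus1_eq[of "2 * k + 1" "n + k"]
  by simp

text \<open>The factor at \<open>j\<close> is \<open>- (n - j) * (n + j + 1)\<close>, so for
  \<open>k \<le> n\<close> the product is \<open>(- 1) ^ k * (n + k)! / (n - k)!\<close>. The
  induction compares the ratios of successive terms.\<close>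

lemma qpoch_neg_binomial:
  "qpoch (- of_nat n) k / fact (2 * k) = (- 1) ^ k * of_nat ((n + k) choose (2 * k))"
proof (induction k)
  case (Suc k)
  show ?case
  proof (cases "k < n")
    case False
    then show ?thesis by (simp add: qpoch_neg_eq_0 binomial_eq_0 del: binomial_Suc_Suc)
  next
    case True
    define c where "c = ((n + k) choose (2 * k))"
    define d where "d = ((n + k) choose (2 * k + 1))"
    define e where "e = ((n + k + 1) choose (2 * k + 2))"
    have 1: "(2 * k + 1) * d = (n - k) * c"
      unfolding c_def d_def by (rule times_binomial_odd)
    have 2: "(2 * k + 2) * e = (n + k + 1) * d"
      using Suc_times_binomial[of "2 * k + 1" "n + k"]
      by (simp add: d_def e_def del: binomial_Suc_Suc mult_Suc)
    have "(2 * k + 1) * (2 * k + 2) * e = (n + k + 1) * ((2 * k + 1) * d)"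
      using 2 by (metis mult.assoc mult.commute)
    also have "\<dots> = (n + k + 1) * (n - k) * c" unfolding 1 by (simp only: mult.assoc)
    finally have "of_nat ((2 * k + 1) * (2 * k + 2) * e) = (of_nat ((n + k + 1) * (n - k) * c) :: 'a)"
      by simp
    then have 3: "(2 * of_nat k + 1) * (2 * of_nat k + 2) * (of_nat e :: 'a)
        = (of_nat n + of_nat k + 1) * (of_nat n - of_nat k) * of_nat c"
      using True by (simp only: of_nat_mult of_nat_add of_nat_diff[OF less_imp_le] of_nat_1 of_nat_numeral)
    have "of_nat ((2 * k + 1) * (2 * k + 2)) \<noteq> (0::'a)"
      unfolding of_nat_eq_0_iff by simp
    then have nz: "(2 * of_nat k + 1) * (2 * of_nat k + 2) \<noteq> (0::'a)"
      by (simp only: of_nat_mult of_nat_add of_nat_1 of_nat_numeral not_False_eq_True)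
    have f: "(fact (2 * Suc k) :: 'a) = (2 * of_nat k + 1) * (2 * of_nat k + 2) * fact (2 * k)"
      by (simp add: algebra_simps)
    have "qpoch (- of_nat n) (Suc k) / fact (2 * Suc k)
       = (of_nat k - of_nat n) * (of_nat k + 1 + of_nat n) / ((2 * of_nat k + 1) * (2 * of_nat k + 2))
         * (qpoch (- of_nat n) k / (fact (2 * k) :: 'a))"
      unfolding f by (simp add: qpoch_def)
    also have "\<dots> = (of_nat k - of_nat n) * (of_nat k + 1 + of_nat n) / ((2 * of_nat k + 1) * (2 * of_nat k + 2))
         * ((- 1) ^ k * of_nat c)"
      using Suc.IH by (simp add: c_def)
    also have "\<dots> = (- 1) ^ Suc k * ((of_nat n + of_nat k + 1) * (of_nat n - of_nat k) * of_nat c)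
       / ((2 * of_nat k + 1) * (2 * of_nat k + 2))" by (simp add: algebra_simps)
    also have "\<dots> = (- 1) ^ Suc k * of_nat e"
      unfolding 3[symmetric] using nz by simp
    finally show ?thesis by (simp add: e_def)
  qed
qed (simp add: qpoch_def)

text \<open>Multiplying by \<open>s ^ k\<close> and summing turns the shifted term
  \<open>c1 k\<close> into \<open>s\<close> times the sum of \<open>c1\<close>, up to the
  overhanging top term on the left. With \<open>s = - t\<close> the factor \<open>2 + s\<close> is
  the \<open>2 * x\<close> of the recurrence of \<open>w\<close> at
  \<open>x = 1 - t / 2\<close>.\<close>

lemma sum_second_difference:
  fixes s :: "'a::comm_ring_1"
  assumes "c2 0 = 2 * c1 0 - c0 0"
    and "\<And>k. c2 (Suc k) = 2 * c1 (Suc k) - c0 (Suc k) + c1 k"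
  shows "(\<Sum>k\<le>M. c2 k * s ^ k) + c1 M * s ^ Suc M
    = (2 + s) * (\<Sum>k\<le>M. c1 k * s ^ k) - (\<Sum>k\<le>M. c0 k * s ^ k)"
proof (induction M)
  case (Suc M)
  then show ?case by (simp add: assms(2) algebra_simps)
qed (simp add: assms(1) algebra_simps)

lemma binomial_second_difference:
  "of_nat (Suc (Suc n) choose Suc (Suc k))
    = 2 * of_nat (Suc n choose Suc (Suc k)) - of_nat (n choose Suc (Suc k))
      + (of_nat (n choose k) :: 'a::comm_ring_1)"
  by (simp add: algebra_simps)

text \<open>At \<open>x = t / 2 - 1\<close> the alternating sign replaces \<open>2 * x\<close> by
  \<open>- 2 * x = 2 - t\<close> in the recurrence. The bound \<open>M\<close> is free so that three
  consecutive instances share one range; the extra terms vanish.\<close>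

lemma poly_w_even_binomial:
  fixes t :: "'a::field_char_0"
  assumes "n \<le> M"
  shows "(- 1) ^ n * poly (w n) (t / 2 - 1)
    = (\<Sum>k\<le>M. of_nat ((n + k) choose (2 * k)) * (- t) ^ k)"
  using assms
proof (induction n rule: w.induct)
  case 1
  have "(\<Sum>k\<le>M. of_nat ((0 + k) choose (2 * k)) * (- t) ^ k)
    = (\<Sum>k\<in>{0}. of_nat ((0 + k) choose (2 * k)) * (- t) ^ k)"
    by (rule sum.mono_neutral_right) auto
  then show ?case by simp
next
  case 2
  have "(\<Sum>k\<le>M. of_nat ((Suc 0 + k) choose (2 * k)) * (- t) ^ k)
    = (\<Sum>k\<in>{0, 1}. of_nat ((Suc 0 + k) choose (2 * k)) * (- t) ^ k)"
    using 2 by (intro sum.mono_neutral_right) auto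
  then show ?case by (simp add: numeral_2_eq_2[symmetric])
next
  case (3 n)
  let ?c = "\<lambda>n k. of_nat ((n + k) choose (2 * k)) :: 'a"
  have "?c (Suc (Suc n)) (Suc k) = 2 * ?c (Suc n) (Suc k) - ?c n (Suc k) + ?c (Suc n) k" for k
    using binomial_second_difference[of "Suc (n + k)" "2 * k", where 'a = 'a]
    by (simp del: binomial_Suc_Suc)
  from sum_second_difference[of "?c (Suc (Suc n))" "?c (Suc n)" "?c n", OF _ this, where M = M and s = "- t"]
  have "(\<Sum>k\<le>M. ?c (Suc (Suc n)) k * (- t) ^ k)
    = (2 - t) * (\<Sum>k\<le>M. ?c (Suc n) k * (- t) ^ k) - (\<Sum>k\<le>M. ?c n k * (- t) ^ k)"
    \<comment> \<open>The overhanging coefficient is \<open>(n + 1 + M) choose (2 * M)\<close>,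
      which is zero because \<open>M\<close> is at least \<open>n + 2\<close>.\<close>
    using "3.prems" by (simp add: binomial_eq_0 del: binomial_Suc_Suc)
  also have "\<dots> = (2 - t) * ((- 1) ^ Suc n * poly (w (Suc n)) (t / 2 - 1))
      - (- 1) ^ n * poly (w n) (t / 2 - 1)"
    using 3 by simp
  also have "\<dots> = (- 1) ^ Suc (Suc n) * poly (w (Suc (Suc n))) (t / 2 - 1)"
    by (simp add: algebra_simps)
  finally show ?case by simp
qed

text \<open>\<open>w n\<close> is the sum of the Chebyshev polynomials of the second kind of degrees
  \<open>n\<close> and \<open>n - 1\<close>; the two binomials are their coefficients in powers of
  \<open>- t\<close>.\<close>

lemma poly_w_odd_binomial:
  fixes t :: "'a::field_char_0"
  assumes "n \<le> M"
  shows "poly (w n) (1 - t / 2)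
    = (\<Sum>k\<le>M. of_nat ((Suc (n + k) choose Suc (2 * k)) + ((n + k) choose Suc (2 * k))) * (- t) ^ k)"
  using assms
proof (induction n rule: w.induct)
  case 1
  let ?f = "\<lambda>k. of_nat ((Suc (0 + k) choose Suc (2 * k)) + ((0 + k) choose Suc (2 * k))) * (- t) ^ k"
  have "(\<Sum>k\<le>M. ?f k) = (\<Sum>k\<in>{0}. ?f k)"
    by (rule sum.mono_neutral_right) (auto simp: binomial_eq_0 simp del: binomial_Suc_Suc)
  then show ?case by simp
next
  case 2
  let ?f = "\<lambda>k. of_nat ((Suc (Suc 0 + k) choose Suc (2 * k)) + ((Suc 0 + k) choose Suc (2 * k))) * (- t) ^ k"
  have "(\<Sum>k\<le>M. ?f k) = (\<Sum>k\<in>{0, 1}. ?f k)"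
    using 2 by (intro sum.mono_neutral_right) (auto simp: binomial_eq_0 simp del: binomial_Suc_Suc)
  then show ?case by (simp add: binomial_eq_0 eval_nat_numeral)
next
  case (3 n)
  let ?c = "\<lambda>n k. of_nat ((Suc (n + k) choose Suc (2 * k)) + ((n + k) choose Suc (2 * k))) :: 'a"
  have "?c (Suc (Suc n)) (Suc k) = 2 * ?c (Suc n) (Suc k) - ?c n (Suc k) + ?c (Suc n) k" for k
    by (simp only: of_nat_add add_Suc add_Suc_right mult_Suc_right add_2_eq_Suc
          binomial_second_difference[of "Suc (n + k)" "Suc (2 * k)"]
          binomial_second_difference[of "Suc (Suc (n + k))" "Suc (2 * k)"])
       (simp add: algebra_simps del: binomial_Suc_Suc)
  from sum_second_difference[of "?c (Suc (Suc n))" "?c (Suc n)" "?c n", OF _ this, where M = M and s = "- t"]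
  have "(\<Sum>k\<le>M. ?c (Suc (Suc n)) k * (- t) ^ k)
    = (2 - t) * (\<Sum>k\<le>M. ?c (Suc n) k * (- t) ^ k) - (\<Sum>k\<le>M. ?c n k * (- t) ^ k)"
    using "3.prems" by (simp add: binomial_eq_0 del: binomial_Suc_Suc)
  also have "\<dots> = (2 - t) * poly (w (Suc n)) (1 - t / 2) - poly (w n) (1 - t / 2)"
    using 3 by simp
  also have "\<dots> = poly (w (Suc (Suc n))) (1 - t / 2)"
    by (simp add: algebra_simps)
  finally show ?case by simp
qed

lemma poly_w_even:
  fixes t :: "'a::field_char_0"
  shows "(- 1) ^ n * poly (w n) (t / 2 - 1)
    = (\<Sum>k\<le>n. qpoch (- of_nat n) k / fact (2 * k) * t ^ k)"
  unfolding poly_w_even_binomial[OF order_refl] qpoch_neg_binomial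
  by (simp add: power_minus[of t] mult_ac)

text \<open>By Pascal's rule the coefficient is
  \<open>?c + 2 * ((n + k) choose (2 * k + 1))\<close>. Multiplied by \<open>2 * k + 1\<close> it
  becomes \<open>(2 * k + 1 + 2 * (n - k)) * ?c\<close>, where \<open>k\<close> drops out.\<close>

lemma poly_w_odd:
  fixes t :: "'a::field_char_0"
  shows "poly (w n) (1 - t / 2)
    = (2 * of_nat n + 1) * (\<Sum>k\<le>n. qpoch (- of_nat n) k / fact (2 * k + 1) * t ^ k)"
  unfolding poly_w_odd_binomial[OF order_refl] sum_distrib_left
proof (rule sum.cong[OF refl])
  fix k assume "k \<in> {..n}"
  then have k: "k \<le> n" by simp
  let ?c = "(n + k) choose (2 * k)"
  let ?d = "(Suc (n + k) choose Suc (2 * k)) + ((n + k) choose Suc (2 * k))"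
  have "(2 * k + 1) * ?d = (2 * k + 1) * ?c + 2 * ((2 * k + 1) * ((n + k) choose (2 * k + 1)))"
    by (simp add: algebra_simps)
  also have "\<dots> = (2 * k + 1 + 2 * (n - k)) * ?c"
    unfolding times_binomial_odd by (simp add: algebra_simps)
  also have "\<dots> = (2 * n + 1) * ?c" using k by simp
  finally have "of_nat ((2 * k + 1) * ?d) = (of_nat ((2 * n + 1) * ?c) :: 'a)" by (rule arg_cong)
  then have d: "of_nat (2 * k + 1) * (of_nat ?d :: 'a) = (2 * of_nat n + 1) * of_nat ?c"
    by (simp only: of_nat_mult of_nat_add of_nat_1 of_nat_numeral)
  have nz: "of_nat (2 * k + 1) \<noteq> (0 :: 'a)" by (simp only: of_nat_eq_0_iff)
  have "(2 * of_nat n + 1) * (qpoch (- of_nat n) k / fact (2 * k + 1) * t ^ k)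
     = (2 * of_nat n + 1) * (qpoch (- of_nat n) k / fact (2 * k)) / of_nat (2 * k + 1) * t ^ k"
    by (simp add: fact_reduce[of "2 * k + 1"] mult_ac)
  also have "\<dots> = (of_nat (2 * k + 1) * of_nat ?d) / of_nat (2 * k + 1) * (- t) ^ k"
    unfolding qpoch_neg_binomial d by (simp add: power_minus[of t] mult_ac)
  also have "\<dots> = of_nat ?d * (- t) ^ k" using nz by simp
  finally show "of_nat ?d * (- t) ^ k
     = (2 * of_nat n + 1) * (qpoch (- of_nat n) k / fact (2 * k + 1) * t ^ k)" by simp
qed

section \<open>Reduction modulo \<open>p\<close>\<close>

lemma rat_cong_qpoch:
  assumes "prime p" "rat_cong a b p"
  shows "rat_cong (qpoch a k) (qpoch b k) p"
  unfolding qpoch_def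
  by (intro rat_cong_prod rat_cong_mult rat_cong_add rat_cong_diff rat_cong_refl assms)
     (use assms in auto)

text \<open>The only multiple of \<open>p\<close> among the factors \<open>1, ..., L\<close> is
  \<open>p\<close> itself.\<close>

lemma fact_eq_prime_mult:
  assumes "prime p" "p \<le> L" "L < 2 * p"
  shows "\<exists>u. fact L = p * u \<and> \<not> p dvd u"
  using assms(2,3)
proof (induction L rule: dec_induct)
  case base
  have "fact p = p * fact (p - 1)" using assms(1) by (simp add: fact_reduce prime_gt_0_nat)
  moreover have "\<not> p dvd fact (p - 1)"
    using assms(1) prime_gt_0_nat[of p] by (simp add: prime_dvd_fact_iff)
  ultimately show ?case by blast
next
  case (step L)
  then obtain u where u: "fact L = p * u" "\<not> p dvd u" by auto
  have "\<not> p dvd Suc L"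
  proof
    assume "p dvd Suc L"
    then obtain c where c: "Suc L = p * c" by blast
    then have "p * 1 < p * c" "p * c < p * 2" using step by linarith+
    then show False by simp
  qed
  then have "\<not> p dvd Suc L * u" using u(2) assms(1) prime_dvd_multD by blast
  moreover have "fact (Suc L) = p * (Suc L * u)" using u(1) by (simp add: algebra_simps)
  ultimately show ?case by blast
qed

text \<open>All factorials below \<open>p!\<close> are units modulo \<open>p\<close>, so the
  parameter may be changed termwise. The offset \<open>e\<close> serves both \<open>(2 * k)!\<close>
  and \<open>(2 * k + 1)!\<close>.\<close>

lemma rat_cong_low_sum:
  fixes t :: rat
  assumes p: "prime p" and t: "t \<in> D p" and ab: "rat_cong a b p"
    and I: "\<And>k. k \<in> I \<Longrightarrow> 2 * k + e < p"
  shows "rat_cong (\<Sum>k\<in>I. qpoch a k / fact (2 * k + e) * t ^ k)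
    (\<Sum>k\<in>I. qpoch b k / fact (2 * k + e) * t ^ k) p"
proof (rule rat_cong_sum[OF p])
  fix k assume "k \<in> I"
  then have "\<not> p dvd fact (2 * k + e)" using I p by (simp add: prime_dvd_fact_iff not_le)
  from rat_cong_divide[OF p rat_cong_qpoch[OF p ab] this, of k]
  have "rat_cong (qpoch a k / fact (2 * k + e)) (qpoch b k / fact (2 * k + e)) p"
    by (simp only: of_nat_fact)
  then show "rat_cong (qpoch a k / fact (2 * k + e) * t ^ k) (qpoch b k / fact (2 * k + e) * t ^ k) p"
    using p t by (intro rat_cong_mult rat_cong_refl D_power)
qed

section \<open>The parameters \<open>a\<close>, \<open>- n\<close> and \<open>- N\<close> compared
  modulo \<open>p\<close>\<close>

context
  fixes p m n r N :: nat and a :: rat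
  assumes p: "prime p" "p > 3" and m: "m \<ge> 3" "\<not> p dvd m"
    and pn: "p = m * n + r" and pN: "p = n + N + 1"
    and a: "a = of_nat r / of_nat m"
begin

text \<open>Since \<open>m \<ge> 3\<close>, \<open>n\<close> is at most \<open>p / 3\<close>. Hence
  the low factorials, and \<open>1 + 2 * n\<close>, are prime to \<open>p\<close>.\<close>

lemma two_n_less: "2 * n + 1 < p"
proof -
  have "3 * n \<le> m * n" using m(1) by simp
  then show ?thesis using pn p(2) by linarith
qed

lemma a_plus_n: "of_nat n + a = of_nat p / of_nat m"
  using m(1) by (simp add: a pn field_simps)

lemma inv_m_D: "1 / of_nat m \<in> D p"
  using D_divide_of_nat[OF p(1) _ m(2), of 1] p(1) by simp

lemma a_cong: "rat_cong a (- of_nat n) p"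
proof -
  have eq: "a = of_nat p * (1 / of_nat m) - of_nat n" using a_plus_n by (simp add: algebra_simps)
  have "a \<in> D p" unfolding eq using inv_m_D p(1) by (intro D_diff D_mult D_of_nat)
  then show ?thesis unfolding rat_cong_iff[OF p(1)]
    using inv_m_D p(1) by (auto simp: eq intro!: bexI[of _ "1 / of_nat m"])
qed

text \<open>The two numbers differ by exactly \<open>p\<close>. The form \<open>1 + N\<close> is the
  partner of \<open>- N\<close> under \<open>qpoch_swap\<close>.\<close>

lemma neg_n_cong: "rat_cong (1 + of_nat N) (- of_nat n) p"
  unfolding rat_cong_iff[OF p(1)] using p(1)
  by (auto simp: pN intro!: bexI[of _ 1])

lemma a_cong_N: "rat_cong a (1 + of_nat N) p"
  using a_cong neg_n_cong p(1) rat_cong_sym rat_cong_trans by blast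

text \<open>The factor at \<open>j = n\<close> carries the \<open>p\<close> that cancels the one in the factorial: it is
  \<open>(p / m) (n + 1 - a)\<close> on the left and \<open>p (n - N)\<close> on the right, which is where \<open>1 / m\<close> comes from.\<close>

lemma high_coeff_cong:
  assumes k: "n < k" and L: "p \<le> L" "L < 2 * p"
  shows "rat_cong (qpoch a k / fact L) (1 / of_nat m * (qpoch (- of_nat N) k / fact L)) p"
proof -
  let ?b = "1 + of_nat N :: rat"
  let ?f = "\<lambda>x j. (of_nat j + x) * (of_nat j + 1 - x :: rat)"
  let ?P = "\<lambda>x. \<Prod>j\<in>{..<k} - {n}. ?f x j"
  have q: "qpoch x k = ?f x n * ?P x" for x
    unfolding qpoch_def using k by (subst prod.remove[of _ n]) auto
  obtain u where u: "fact L = p * u" "\<not> p dvd u" using fact_eq_prime_mult p(1) L by blast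
  have "fact L = (of_nat (fact L) :: rat)" by simp
  also have "\<dots> = of_nat p * of_nat u" unfolding u(1) by simp
  finally have fu: "fact L = (of_nat p * of_nat u :: rat)" .
  have p0: "of_nat p \<noteq> (0 :: rat)" using p(2) by simp
  have 1: "qpoch a k / fact L = 1 / of_nat m * ((of_nat n + 1 - a) * ?P a) / of_nat u"
    unfolding q a_plus_n fu using p0 by simp
  have bp: "of_nat n + ?b = of_nat p" by (simp add: pN)
  have 2: "qpoch (- of_nat N) k / fact L = ((of_nat n + 1 - ?b) * ?P ?b) / of_nat u"
    using qpoch_swap[of ?b k] p0 unfolding q[of ?b] bp fu by simp
  \<comment> \<open>Only now, with \<open>p\<close> cancelled and the denominator \<open>u\<close> a
    unit, may \<open>a\<close> be replaced by \<open>1 + N\<close>.\<close>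
  have "rat_cong (1 / of_nat m * ((of_nat n + 1 - a) * ?P a)) (1 / of_nat m * ((of_nat n + 1 - ?b) * ?P ?b)) p"
    by (intro rat_cong_mult rat_cong_prod rat_cong_add rat_cong_diff rat_cong_refl a_cong_N p(1) inv_m_D)
       (use p(1) in auto)
  from rat_cong_divide[OF p(1) this u(2)] show ?thesis unfolding 1 2 by simp
qed

text \<open>\<open>h\<close> is the first index whose factorial contains \<open>p\<close>. From
  there on the terms are \<open>1 / m\<close> times the tail of the sum for \<open>- N\<close>; the
  part cut off below \<open>h\<close> reduces to the sum for \<open>- n\<close>. Integrality of the
  full sum is assumed here and later read off from \<open>w N\<close>.\<close>

lemma high_sum_cong:
  assumes t: "t \<in> D p" and h: "\<And>k. k < h \<longleftrightarrow> 2 * k + e < p" and e: "e \<le> 1"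
    and wN: "(\<Sum>k\<le>N. qpoch (- of_nat N) k / fact (2 * k + e) * t ^ k) \<in> D p"
  shows "rat_cong (\<Sum>k = h..N. qpoch a k / fact (2 * k + e) * t ^ k)
    (1 / of_nat m * ((\<Sum>k\<le>N. qpoch (- of_nat N) k / fact (2 * k + e) * t ^ k)
       - (\<Sum>k\<le>n. qpoch (- of_nat n) k / fact (2 * k + e) * t ^ k))) p"
proof -
  let ?F = "\<lambda>x k. qpoch x k / fact (2 * k + e) * t ^ k"
  have nh: "n < h" using h two_n_less e by auto
  have hN: "h \<le> N"
  proof -
    have "\<not> 2 * N + e < p" using two_n_less pN by linarith
    then show ?thesis using h by (meson not_le)
  qed
  have "rat_cong (?F a k) (1 / of_nat m * ?F (- of_nat N) k) p" if "k \<in> {h..N}" for k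
  proof -
    have "n < k" using that nh by simp
    moreover have "p \<le> 2 * k + e" using that h[of k] by auto
    moreover have "2 * k + e < 2 * p" using that e pN by auto
    ultimately have "rat_cong (qpoch a k / fact (2 * k + e) * t ^ k)
        (1 / of_nat m * (qpoch (- of_nat N) k / fact (2 * k + e)) * t ^ k) p"
      using p(1) t by (intro rat_cong_mult rat_cong_refl D_power high_coeff_cong)
    then show ?thesis by (simp only: mult.assoc)
  qed
  then have 1: "rat_cong (\<Sum>k = h..N. ?F a k) (1 / of_nat m * (\<Sum>k = h..N. ?F (- of_nat N) k)) p"
    unfolding sum_distrib_left by (intro rat_cong_sum p(1))
  have split: "(\<Sum>k = h..N. ?F (- of_nat N) k)
      = (\<Sum>k\<le>N. ?F (- of_nat N) k) - (\<Sum>k<h. ?F (- of_nat N) k)"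
  proof -
    have "{..N} = {..<h} \<union> {h..N}" using hN by auto
    then have "(\<Sum>k\<le>N. ?F (- of_nat N) k) = (\<Sum>k<h. ?F (- of_nat N) k) + (\<Sum>k = h..N. ?F (- of_nat N) k)"
      by (simp only:) (rule sum.union_disjoint, auto)
    then show ?thesis by simp
  qed
  \<comment> \<open>After the swap the left side is the sum for \<open>- N\<close>; on the right the
    terms with \<open>n < k < h\<close> are zero.\<close>
  have "rat_cong (\<Sum>k<h. ?F (1 + of_nat N) k) (\<Sum>k<h. ?F (- of_nat n) k) p"
    using h by (intro rat_cong_low_sum p(1) t neg_n_cong) auto
  moreover have "qpoch (1 + of_nat N) k = qpoch (- of_nat N :: rat) k" for k
    using qpoch_swap[of "- of_nat N :: rat" k] by simp
  moreover have "(\<Sum>k<h. ?F (- of_nat n) k) = (\<Sum>k\<le>n. ?F (- of_nat n) k)"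
    using nh by (intro sum.mono_neutral_right) (auto simp: qpoch_neg_eq_0)
  ultimately have 2: "rat_cong (\<Sum>k<h. ?F (- of_nat N) k) (\<Sum>k\<le>n. ?F (- of_nat n) k) p" by simp
  have "rat_cong (1 / of_nat m * ((\<Sum>k\<le>N. ?F (- of_nat N) k) - (\<Sum>k<h. ?F (- of_nat N) k)))
    (1 / of_nat m * ((\<Sum>k\<le>N. ?F (- of_nat N) k) - (\<Sum>k\<le>n. ?F (- of_nat n) k))) p"
    using 2 wN p(1) inv_m_D by (intro rat_cong_mult rat_cong_diff rat_cong_refl)
  with 1[unfolded split] show ?thesis using p(1) by (rule rat_cong_trans)
qed

lemma D_divide_n: "x \<in> D p \<Longrightarrow> x / (1 + 2 * of_nat n) \<in> D p"
proof -
  have "\<not> p dvd 1 + 2 * n" using two_n_less by (auto dest: dvd_imp_le)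
  then show "x \<in> D p \<Longrightarrow> x / (1 + 2 * of_nat n) \<in> D p"
    using D_divide_of_nat[OF p(1), of x "1 + 2 * n"] by simp
qed

lemma D_divide_N: "x \<in> D p \<Longrightarrow> x / (1 + 2 * of_nat N) \<in> D p"
proof -
  have "\<not> p dvd 1 + 2 * N"
  proof
    assume "p dvd 1 + 2 * N"
    moreover have "(1 + 2 * N) + (1 + 2 * n) = p * 2" using pN by simp
    ultimately have "p dvd 1 + 2 * n" by (metis dvd_add_right_iff dvd_triv_left)
    then show False using two_n_less by (auto dest: dvd_imp_le)
  qed
  then show "x \<in> D p \<Longrightarrow> x / (1 + 2 * of_nat N) \<in> D p"
    using D_divide_of_nat[OF p(1), of x "1 + 2 * N"] by simp
qed

lemma w_congruences:
  assumes t: "t \<in> D p"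
  shows "rat_cong (\<Sum>k\<le>n. qpoch a k / fact (2 * k + 1) * t ^ k)
      (1 / (1 + 2 * of_nat n) * poly (w n) (1 - t / 2)) p" (is ?A)
    and "rat_cong (\<Sum>k\<le>n. qpoch a k / fact (2 * k) * t ^ k)
      ((- 1) ^ n * poly (w n) (t / 2 - 1)) p" (is ?B)
    and "rat_cong (\<Sum>k = (p - 1) div 2..N. qpoch a k / fact (2 * k + 1) * t ^ k)
      (- 1 / (of_nat m * (1 + 2 * of_nat n)) * (poly (w N) (1 - t / 2) + poly (w n) (1 - t / 2))) p" (is ?C)
    and "rat_cong (\<Sum>k = (p + 1) div 2..N. qpoch a k / fact (2 * k) * t ^ k)
      ((- 1) ^ n / of_nat m * (poly (w N) (t / 2 - 1) - poly (w n) (t / 2 - 1))) p" (is ?D)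
proof -
  let ?S = "\<lambda>e M. \<Sum>k\<le>M. qpoch (- of_nat M) k / fact (2 * k + e) * t ^ k"
  let ?n = "1 + 2 * of_nat n :: rat" and ?N = "1 + 2 * of_nat N :: rat"
  have frac: "1 / x * (- (u / y) - v / y) = - 1 / (x * y) * (u + v)" for x y u v :: rat
    by (simp add: add_divide_distrib algebra_simps)
  have odd: "odd p" using p by (simp add: prime_odd_nat)
  have nz: "?n \<noteq> 0" "?N \<noteq> 0"
    by (metis of_nat_1 of_nat_add of_nat_mult of_nat_numeral of_nat_eq_0_iff add_is_0 one_neq_zero)+
  have S1: "?S 1 M = poly (w M) (1 - t / 2) / (1 + 2 * of_nat M)" if "1 + 2 * of_nat M \<noteq> (0 :: rat)" for M
    using that by (simp add: poly_w_odd[of M t] add.commute)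
  have S0: "?S 0 M = (- 1) ^ M * poly (w M) (t / 2 - 1)" for M
    by (simp add: poly_w_even)
  have "\<not> p dvd 2" using p(2) by (auto dest: dvd_imp_le)
  then have t2: "t / 2 \<in> D p" using D_divide_of_nat[OF p(1) t, of 2] by simp
  have w: "poly (w M) (1 - t / 2) \<in> D p" "poly (w M) (t / 2 - 1) \<in> D p" for M
    using t2 p(1) by (auto intro!: D_poly_w)
  have "rat_cong (\<Sum>k\<le>n. qpoch a k / fact (2 * k + 1) * t ^ k) (?S 1 n) p"
    using two_n_less by (intro rat_cong_low_sum p(1) t a_cong) auto
  then show ?A unfolding S1[OF nz(1)] by simp
  \<comment> \<open>The summand \<open>0\<close> matches the offset \<open>e = 0\<close>.\<close>
  have "rat_cong (\<Sum>k\<le>n. qpoch a k / fact (2 * k + 0) * t ^ k) (?S 0 n) p"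
    using two_n_less by (intro rat_cong_low_sum p(1) t a_cong) auto
  then show ?B unfolding S0 by simp
  have SN: "?S 1 N \<in> D p" unfolding S1[OF nz(2)] by (intro D_divide_N w)
  \<comment> \<open>As \<open>p\<close> is odd, \<open>2 * k + 1 < p\<close> holds exactly for
    \<open>k\<close> below \<open>(p - 1) div 2\<close>.\<close>
  have "rat_cong (\<Sum>k = (p - 1) div 2..N. qpoch a k / fact (2 * k + 1) * t ^ k)
      (1 / of_nat m * (?S 1 N - ?S 1 n)) p"
    by (rule high_sum_cong) (use t SN odd in \<open>auto elim!: oddE\<close>)
  \<comment> \<open>\<open>?N + ?n\<close> is \<open>2 * p\<close>, so \<open>1 / ?N\<close> is
    congruent to \<open>- 1 / ?n\<close>; this gives the common denominator and the minus sign of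
    \<open>?C\<close>. The congruence prepares the next link of the chain.\<close>
  also have "rat_cong (?S 1 N) (- (poly (w N) (1 - t / 2) / ?n)) p"
    unfolding rat_cong_iff[OF p(1)]
  proof (intro conjI SN bexI)
    show "- (poly (w N) (1 - t / 2) / ?n) \<in> D p"
      using p(1) by (intro D_uminus D_divide_n w)
    show "2 * poly (w N) (1 - t / 2) / ?n / ?N \<in> D p"
      using p(1) by (intro D_divide_n D_divide_N D_mult w) auto
    have "?N + ?n = 2 * of_nat p" by (simp add: pN)
    moreover have "?S 1 N - - (poly (w N) (1 - t / 2) / ?n) = poly (w N) (1 - t / 2) * (?N + ?n) / ?n / ?N"
      unfolding S1[OF nz(2)] using nz by (simp add: field_simps)
    ultimately show "?S 1 N - - (poly (w N) (1 - t / 2) / ?n)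
        = of_nat p * (2 * poly (w N) (1 - t / 2) / ?n / ?N)" by simp
  qed
  then have "rat_cong (1 / of_nat m * (?S 1 N - ?S 1 n))
      (1 / of_nat m * (- (poly (w N) (1 - t / 2) / ?n) - poly (w n) (1 - t / 2) / ?n)) p"
    unfolding S1[OF nz(1)]
    by (intro rat_cong_mult rat_cong_diff rat_cong_refl p(1) inv_m_D D_divide_n w)
  also have "1 / of_nat m * (- (poly (w N) (1 - t / 2) / ?n) - poly (w n) (1 - t / 2) / ?n)
      = - 1 / (of_nat m * ?n) * (poly (w N) (1 - t / 2) + poly (w n) (1 - t / 2))"
    by (rule frac)
  finally show ?C using p(1) by simp
  \<comment> \<open>\<open>n + N = p - 1\<close> is even, so \<open>n\<close> and \<open>N\<close>
    have the same parity.\<close>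
  have par: "(- 1) ^ N = ((- 1) ^ n :: rat)"
    using odd pN by (auto simp: minus_one_power_iff)
  have "?S 0 N \<in> D p" unfolding S0 using p(1) by (intro D_mult D_power D_uminus w) auto
  then have "rat_cong (\<Sum>k = (p + 1) div 2..N. qpoch a k / fact (2 * k + 0) * t ^ k)
      (1 / of_nat m * (?S 0 N - ?S 0 n)) p"
    by (intro high_sum_cong) (use t odd in \<open>auto elim!: oddE\<close>)
  then show ?D unfolding S0 par by (simp add: algebra_simps)
qed

end

section \<open>Specialisation to \<open>m = 3, 4, 6\<close>\<close>

theorem theorem1:
  fixes m p :: nat and t :: rat
  assumes "m \<in> {3, 4, 6}"
    and "prime p" and "p > 3"
    and "t \<in> D p"
  shows
    "rat_cong
       (\<Sum>k = 0..p div m.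
          pochhammer (1 / of_nat m) k * pochhammer (of_nat (m - 1) / of_nat m) k
            / fact (2 * k + 1) * t ^ k)
       (1 / (1 + 2 * of_nat (p div m)) * poly (w (p div m)) (1 - t / 2)) p \<and>
     rat_cong
       (\<Sum>k = 0..p div m.
          pochhammer (1 / of_nat m) k * pochhammer (of_nat (m - 1) / of_nat m) k
            / fact (2 * k) * t ^ k)
       ((- 1) ^ (p div m) * poly (w (p div m)) (t / 2 - 1)) p \<and>
     rat_cong
       (\<Sum>k = (p - 1) div 2..(m - 1) * p div m.
          pochhammer (1 / of_nat m) k * pochhammer (of_nat (m - 1) / of_nat m) k
            / fact (2 * k + 1) * t ^ k)
       (- 1 / (of_nat m * (1 + 2 * of_nat (p div m))) *
          (poly (w ((m - 1) * p div m)) (1 - t / 2) + poly (w (p div m)) (1 - t / 2))) p \<and>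
     rat_cong
       (\<Sum>k = (p + 1) div 2..(m - 1) * p div m.
          pochhammer (1 / of_nat m) k * pochhammer (of_nat (m - 1) / of_nat m) k
            / fact (2 * k) * t ^ k)
       ((- 1) ^ (p div m) / of_nat m *
          (poly (w ((m - 1) * p div m)) (t / 2 - 1) - poly (w (p div m)) (t / 2 - 1))) p"
proof -
  define n where "n = p div m"
  define N where "N = p - 1 - n"
  define a :: rat where "a = of_nat (p mod m) / of_nat m"
  have nd: "\<not> 2 dvd p" "\<not> 3 dvd p"
  proof -
    have "q = 1 \<or> q = p" if "q dvd p" for q
      using assms(2) that prime_nat_iff by blast
    from this[of 2] this[of 3] show "\<not> 2 dvd p" "\<not> 3 dvd p" using assms(3) by auto
  qed
  have "p mod 3 = 1 \<or> p mod 3 = 2" "p mod 4 = 1 \<or> p mod 4 = 3" "p mod 6 = 1 \<or> p mod 6 = 5"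
    using nd by presburger+
  \<comment> \<open>For these \<open>m\<close> the only residues coprime to \<open>m\<close> are
    \<open>1\<close> and \<open>m - 1\<close>.\<close>
  then have r: "p mod m = 1 \<or> p mod m = m - 1" using assms(1) by auto
  have "p div m < p" using assms(1,3) by auto
  then have pN: "p = n + N + 1" unfolding N_def n_def by simp
  have pn: "p = m * n + p mod m" unfolding n_def by simp
  have m: "m \<ge> 3" "\<not> p dvd m"
  proof -
    \<comment> \<open>\<open>12\<close> is a common multiple of \<open>3\<close>, \<open>4\<close>
      and \<open>6\<close> with prime factors \<open>2\<close> and \<open>3\<close> only.\<close>
    have "\<not> p dvd 2 * 2 * 3"
    proof
      assume "p dvd 2 * 2 * 3"
      then have "p dvd 2 \<or> p dvd 3" using assms(2) prime_dvd_multD by blast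
      then show False using assms(3) by (auto dest: dvd_imp_le)
    qed
    moreover have "m dvd 2 * 2 * 3" using assms(1) by auto
    ultimately show "\<not> p dvd m" using dvd_trans by blast
  qed (use assms(1) in auto)
  have a': "1 - 1 / of_nat m = (of_nat (m - 1) / of_nat m :: rat)"
    using m(1) by (simp add: of_nat_diff field_simps)
  \<comment> \<open>The residue \<open>m - 1\<close> gives \<open>a = 1 - 1 / m\<close>, which the
    swap takes to \<open>1 / m\<close>.\<close>
  have "qpoch a k = qpoch (1 / of_nat m) k" for k
    using r qpoch_swap[of "1 / of_nat m :: rat" k] unfolding a_def a' by auto
  then have q: "pochhammer (1 / of_nat m) k * pochhammer (of_nat (m - 1) / of_nat m) k = qpoch a k" for k
    unfolding qpoch_eq_pochhammer[of "1 / of_nat m"] a' by simp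
  \<comment> \<open>\<open>(m - 1) * p = m * N + (m - p mod m)\<close>, and the last term lies
    strictly between \<open>0\<close> and \<open>m\<close>.\<close>
  have N: "(m - 1) * p div m = N"
  proof -
    have "(m - 1) * p + p = m * p" using m(1) by (simp add: diff_mult_distrib)
    also have "\<dots> = m * n + m * N + m" by (subst pN) (simp add: algebra_simps)
    finally have "(m - 1) * p + p mod m = m * N + m" using pn by linarith
    moreover have "0 < p mod m" "p mod m < m" using r m(1) by auto
    ultimately show ?thesis by (intro div_nat_eqI) auto
  qed
  show ?thesis
    unfolding q N n_def[symmetric] atLeast0AtMost
    using w_congruences[OF assms(2,3) m pn pN a_def assms(4)] by blast
qed

end
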